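(* Let $I\times J=[a,b]\times[c,d]\subset\mathbb{R}^2$, let $M,N\in\mathbb{N}\cup\{0\}$, let $P:I\times J\to\mathbb{R}$ be an integrable function and let $f,g\in C^{(M+1,N+1)}(I\times J)$ be two $(M+1,N+1)$-$\nabla$-convex functions on $I\times J$. Let $\Lambda(h)=\int_a^b\int_c^d P(y,z)h(y,z)\,dz\,dy$ and suppose that $$\int_a^b\int_c^d P(y,z)\frac{(b-y)^i}{i!}\frac{(d-z)^j}{j!}\,dz\,dy=0,\quad i\in\{0,\ldots,M\},\ j\in\{0,\ldots,N\};$$ $$\int_a^s\int_c^d P(y,z)\frac{(s-y)^M}{M!}\frac{(d-z)^j}{j!}\,dz\,dy=0,\quad j\in\{0,\ldots,N\},\ \forall s\in[a,b];$$ $$\int_a^b\int_c^t P(y,z)\frac{(b-y)^i}{i!}\frac{(t-z)^N}{N!}\,dz\,dy=0,\quad i\in\{0,\ldots,M\},\ \forall t\in[c,d];$$ $$\int_a^s\int_c^t P(y,z)\frac{(s-y)^M}{M!}\frac{(t-z)^N}{N!}\,dz\,dy\ge 0,\quad \forall s\in[a,b],\ \forall t\in[c,d].$$ Assume the denominators below are nonzero, i.e. $\Lambda(g)\ne 0$ and $g_{(M+1,N+1)}\neq 0$ on $I\times J$. Then there exists $(\eta,\zeta)\in I\times J$ such that $$\frac{\Lambda(f)}{\Lambda(g)}=\frac{f_{(M+1,N+1)}(\eta,\zeta)}{g_{(M+1,N+1)}(\eta,\zeta)}.$$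
   Context: $f_{(i,j)}=\dfrac{\partial^{i+j}f}{\partial y^i\partial z^j}$; $(\cdot)^0=1$. $C^{(M+1,N+1)}(I\times J)$ denotes the functions with continuous partial derivatives $f_{(i,j)}$ for $0\le i\le M+1$, $0\le j\le N+1$. One-variable divided differences at distinct points: $[x_j;h]=h(x_j)$, $[x_i,\ldots,x_{i+l};h]=\dfrac{[x_{i+1},\ldots,x_{i+l};h]-[x_i,\ldots,x_{i+l-1};h]}{x_{i+l}-x_i}$. A function $f:I\times J\to\mathbb{R}$ is $(m,n)$-$\nabla$-convex if $(-1)^{m+n}[y_i,\ldots,y_{i+m};[z_j,\ldots,z_{j+n};f]]\ge 0$ for all distinct points $y_i,\ldots,y_{i+m}\in I$ and distinct $z_j,\ldots,z_{j+n}\in J$; for $f\in C^{(m,n)}(I\times J)$ this is equivalent to $(-1)^{m+n}f_{(m,n)}\ge 0$ on $I\times J$. *)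

theory Defs
  imports "HOL-Analysis.Analysis"
begin

text \<open>
  Functions on \<open>I \<times> J\<close> are curried total functions, of which only the values on \<open>I \<times> J\<close> matter.
  The derivatives are taken within \<open>I\<close> and \<open>J\<close>, so they are one-sided at the ends of closed intervals.
\<close>

definition deriv_fst :: "real set \<Rightarrow> (real \<Rightarrow> real \<Rightarrow> real) \<Rightarrow> real \<Rightarrow> real \<Rightarrow> real" where
  "deriv_fst I f = (\<lambda>y z. vector_derivative (\<lambda>u. f u z) (at y within I))"

definition deriv_snd :: "real set \<Rightarrow> (real \<Rightarrow> real \<Rightarrow> real) \<Rightarrow> real \<Rightarrow> real \<Rightarrow> real" where
  "deriv_snd J f = (\<lambda>y z. vector_derivative (\<lambda>v. f y v) (at z within J))"

definition partial_deriv ::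
    "real set \<Rightarrow> real set \<Rightarrow> nat \<Rightarrow> nat \<Rightarrow> (real \<Rightarrow> real \<Rightarrow> real) \<Rightarrow> real \<Rightarrow> real \<Rightarrow> real" where
  "partial_deriv I J i j f = (deriv_fst I ^^ i) ((deriv_snd J ^^ j) f)"

text \<open>
  The two differentiability clauses say that each derivative used in forming \<^const>\<open>partial_deriv\<close>
  (first \<open>j\<close> times in \<open>z\<close>, then \<open>i\<close> times in \<open>y\<close>) exists; \<^const>\<open>vector_derivative\<close> alone is
  unspecified where there is no derivative.
\<close>

definition C_on ::
    "nat \<Rightarrow> nat \<Rightarrow> real set \<Rightarrow> real set \<Rightarrow> (real \<Rightarrow> real \<Rightarrow> real) \<Rightarrow> bool" where
  "C_on m n I J f \<longleftrightarrow>
     (\<forall>j<n. \<forall>y\<in>I. \<forall>z\<in>J.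
        (\<lambda>v. partial_deriv I J 0 j f y v) differentiable (at z within J)) \<and>
     (\<forall>i<m. \<forall>j\<le>n. \<forall>y\<in>I. \<forall>z\<in>J.
        (\<lambda>u. partial_deriv I J i j f u z) differentiable (at y within I)) \<and>
     (\<forall>i\<le>m. \<forall>j\<le>n. continuous_on (I \<times> J) (\<lambda>(y, z). partial_deriv I J i j f y z))"

text \<open>\<open>divided_difference x i l h\<close> is $[x_i, \ldots, x_{i+l}; h]$.\<close>

primrec divided_difference ::
    "(nat \<Rightarrow> real) \<Rightarrow> nat \<Rightarrow> nat \<Rightarrow> (real \<Rightarrow> real) \<Rightarrow> real" where
  "divided_difference x i 0 h = h (x i)"
| "divided_difference x i (Suc l) h =
     (divided_difference x (Suc i) l h - divided_difference x i l h) / (x (i + Suc l) - x i)"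

definition nabla_convex_on ::
    "nat \<Rightarrow> nat \<Rightarrow> real set \<Rightarrow> real set \<Rightarrow> (real \<Rightarrow> real \<Rightarrow> real) \<Rightarrow> bool" where
  "nabla_convex_on m n I J f \<longleftrightarrow>
     (\<forall>y z. inj_on y {0..m} \<and> y ` {0..m} \<subseteq> I \<and> inj_on z {0..n} \<and> z ` {0..n} \<subseteq> J \<longrightarrow>
        (-1) ^ (m + n) *
          divided_difference y 0 m (\<lambda>u. divided_difference z 0 n (\<lambda>v. f u v)) \<ge> 0)"

definition iterated_integral ::
    "real \<Rightarrow> real \<Rightarrow> real \<Rightarrow> real \<Rightarrow> (real \<Rightarrow> real \<Rightarrow> real) \<Rightarrow> real" where
  "iterated_integral a b c d h = (LINT y:{a..b}|lebesgue. (LINT z:{c..d}|lebesgue. h y z))"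

definition Lambda ::
    "real \<Rightarrow> real \<Rightarrow> real \<Rightarrow> real \<Rightarrow> (real \<Rightarrow> real \<Rightarrow> real) \<Rightarrow> (real \<Rightarrow> real \<Rightarrow> real) \<Rightarrow> real" where
  "Lambda a b c d P h = iterated_integral a b c d (\<lambda>y z. P y z * h y z)"

end

theory Submission
  imports Defs
begin

text \<open>
  Taylor's formula at the right end point, with truncated powers as kernels, is applied first in
  \<open>z\<close> and then in \<open>y\<close>, so no mixed partial derivatives are interchanged. Integrated against \<open>P\<close>,
  all boundary terms vanish by the moment conditions, which leaves
  $\Lambda(f) = (-1)^{M+N} \int\int T(s,t)\, f_{(M+1,N+1)}(s,t)\,ds\,dt$, where
  $T(s,t) = \int_a^s\int_c^t P(y,z) \frac{(s-y)^M}{M!} \frac{(t-z)^N}{N!}\,dz\,dy \ge 0$ does not depend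
  on \<open>f\<close>. Hence $\Lambda(f)/\Lambda(g)$ lies between the extrema of the continuous function
  $f_{(M+1,N+1)}/g_{(M+1,N+1)}$ on a connected set.
\<close>

section \<open>Reduction of Lebesgue iterated integrals to Borel integrals\<close>

text \<open>On a product space \<open>lebesgue\<close> is the completion of the product measure, not
  the product of the two completions, so Fubini's theorem does not apply to \<open>Q\<close>
  directly. It is applied to a Borel function equal to \<open>Q\<close> almost everywhere, and both
  sides are carried back.\<close>

lemma integral_lebesgue_prod:
  fixes Q :: "'a::euclidean_space \<times> 'b::euclidean_space \<Rightarrow> real"
  assumes "integrable lebesgue Q"
  shows "(LINT y|lebesgue. LINT z|lebesgue. Q (y, z)) = integral\<^sup>L lebesgue Q"
proof -
  have Qm: "Q \<in> borel_measurable lebesgue"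
    using assms by auto
  obtain Q' where Q'm: "Q' \<in> borel_measurable lborel" and ae: "AE x in lborel. Q x = Q' x"
    using completion_ex_borel_measurable_real[OF Qm] by blast
  have ae': "AE x in lborel \<Otimes>\<^sub>M lborel. Q x = Q' x"
    using ae by (simp only: lborel_prod)
  have aeL: "AE x in lebesgue. Q x = Q' x"
    using ae by (rule AE_completion)
  have Q'L: "Q' \<in> borel_measurable lebesgue"
    using Q'm by (rule measurable_completion)
  have "integrable lebesgue Q'"
    using assms by (rule integrable_cong_AE_imp) (use aeL Q'L in auto)
  then have int: "integrable (lborel \<Otimes>\<^sub>M lborel) Q'"
    using Q'm by (simp add: integrable_completion lborel_prod)
  have Q'z: "(\<lambda>z. Q' (y, z)) \<in> borel_measurable lborel" for y
    using Q'm by (simp add: borel_prod [symmetric])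
  have inner: "AE y in lborel. (LINT z|lebesgue. Q (y, z)) = (LINT z|lborel. Q' (y, z))"
  proof -
    \<comment> \<open>Almost every section of a null set is null.\<close>
    have "AE y in lborel. AE z in lborel. Q (y, z) = Q' (y, z)"
      by (rule lborel_pair.AE_pair[OF ae'])
    then show ?thesis
    proof eventually_elim
      case (elim y)
      have L: "(\<lambda>z. Q' (y, z)) \<in> borel_measurable lebesgue"
        using Q'z by (rule measurable_completion)
      have e: "AE z in lebesgue. Q (y, z) = Q' (y, z)"
        using elim by (rule AE_completion)
      have "(\<lambda>z. Q (y, z)) \<in> borel_measurable lebesgue"
        by (rule borel_measurable_AE[OF L]) (use e in auto)
      then have "(LINT z|lebesgue. Q (y, z)) = (LINT z|lebesgue. Q' (y, z))"
        using L e by (rule integral_cong_AE)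
      then show ?case
        using Q'z by (simp add: integral_completion)
    qed
  qed
  have outer: "(\<lambda>y. LINT z|lborel. Q' (y, z)) \<in> borel_measurable lborel"
    using lborel_pair.integrable_fst'[OF int] by auto
  then have outerL: "(\<lambda>y. LINT z|lborel. Q' (y, z)) \<in> borel_measurable lebesgue"
    by (rule measurable_completion)
  have innerL: "AE y in lebesgue. (LINT z|lebesgue. Q (y, z)) = (LINT z|lborel. Q' (y, z))"
    using inner by (rule AE_completion)
  have "(LINT y|lebesgue. LINT z|lebesgue. Q (y, z)) = (LINT y|lebesgue. LINT z|lborel. Q' (y, z))"
  proof (rule integral_cong_AE[OF _ outerL innerL])
    \<comment> \<open>Since \<open>lebesgue\<close> is complete, agreeing almost everywhere with a
      measurable function is enough for measurability.\<close>
    show "(\<lambda>y. LINT z|lebesgue. Q (y, z)) \<in> borel_measurable lebesgue"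
      by (rule borel_measurable_AE[OF outerL]) (use innerL in auto)
  qed
  also have "\<dots> = (LINT y|lborel. LINT z|lborel. Q' (y, z))"
    using outer by (rule integral_completion)
  also have "\<dots> = integral\<^sup>L lborel Q'"
    using lborel_pair.integral_fst'[OF int] by (simp add: lborel_prod)
  also have "\<dots> = integral\<^sup>L lebesgue Q'"
    using Q'm by (simp add: integral_completion)
  also have "\<dots> = integral\<^sup>L lebesgue Q"
    using Q'L Qm aeL by (intro integral_cong_AE) auto
  finally show ?thesis .
qed

text \<open>A single Borel density \<open>p\<close> replaces \<open>P\<close> for all upper limits
  \<open>s\<close>, \<open>t\<close> and all continuous \<open>h\<close> at once. From here on the
  iterated integrals become plain integrals over the plane, with the domain of integration encoded
  in an indicator.\<close>

lemma iterated_integral_eq_integral_lborel: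
  assumes P: "set_integrable lebesgue ({a..b} \<times> {c..d}) (\<lambda>(y, z). P y z)"
  obtains p :: "real \<times> real \<Rightarrow> real" where "integrable lborel p"
    and "\<And>x. x \<notin> {a..b} \<times> {c..d} \<Longrightarrow> p x = 0"
    and "\<And>s t h. \<lbrakk>s \<le> b; t \<le> d; continuous_on ({a..b} \<times> {c..d}) (\<lambda>(y, z). h y z)\<rbrakk> \<Longrightarrow>
      iterated_integral a s c t (\<lambda>y z. P y z * h y z) =
      (LINT x|lborel. p x * (indicator ({a..s} \<times> {c..t}) x * h (fst x) (snd x)))"
proof -
  let ?B = "{a..b} \<times> {c..d}"
  define Q where "Q = (\<lambda>x. indicator ?B x * (case x of (y, z) \<Rightarrow> P y z))"
  have Q: "integrable lebesgue Q"
    using P by (simp add: set_integrable_def Q_def)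
  have Qm: "Q \<in> borel_measurable lebesgue"
    using Q by auto
  obtain Q' where Q'm: "Q' \<in> borel_measurable lborel" and ae: "AE x in lborel. Q x = Q' x"
    using completion_ex_borel_measurable_real[OF Qm] by blast
  \<comment> \<open>\<open>Q'\<close> agrees with \<open>Q\<close> only almost everywhere, so it is
    cut off again to vanish at every point outside the rectangle.\<close>
  define p where "p = (\<lambda>x. indicator ?B x * Q' x)"
  have [measurable]: "?B \<in> sets borel"
    by (intro borel_closed closed_Times closed_atLeastAtMost)
  have pm: "p \<in> borel_measurable lborel"
    unfolding p_def using Q'm by measurable
  have aeL: "AE x in lebesgue. Q x = p x"
    using AE_completion[OF ae]
  proof eventually_elim
    case (elim x)
    then show ?case
      by (cases "x \<in> ?B") (auto simp: p_def Q_def simp del: mem_Times_iff)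
  qed
  have "integrable lebesgue p"
    using Q by (rule integrable_cong_AE_imp) (use aeL pm in \<open>auto intro: measurable_completion\<close>)
  then have int: "integrable lborel p"
    using pm by (simp add: integrable_completion)
  have "iterated_integral a s c t (\<lambda>y z. P y z * h y z) =
      (LINT x|lborel. p x * (indicator ({a..s} \<times> {c..t}) x * h (fst x) (snd x)))"
    if s: "s \<le> b" and t: "t \<le> d" and h: "continuous_on ?B (\<lambda>(y, z). h y z)" for s t h
  proof -
    let ?A = "{a..s} \<times> {c..t}"
    define H where "H = (\<lambda>x. indicator ?A x * h (fst x) (snd x))"
    have sub: "?A \<subseteq> ?B"
      using s t by auto
    have hA: "continuous_on ?A (\<lambda>x. h (fst x) (snd x))"
      using continuous_on_subset[OF h sub] by (simp add: case_prod_unfold)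
    have Am [measurable]: "?A \<in> sets borel"
      by (intro borel_closed closed_Times closed_atLeastAtMost)
    have Hm: "H \<in> borel_measurable lborel"
      unfolding H_def using borel_measurable_continuous_on_indicator[OF Am hA] by simp
    have "compact ?A"
      by (intro compact_Times compact_Icc)
    then have "bounded ((\<lambda>x. h (fst x) (snd x)) ` ?A)"
      using hA by (intro compact_imp_bounded compact_continuous_image)
    then obtain C where C: "\<And>x. x \<in> ?A \<Longrightarrow> \<bar>h (fst x) (snd x)\<bar> \<le> C"
      unfolding bounded_iff by fastforce
    \<comment> \<open>\<open>C\<close> may be negative when \<open>?A\<close> is empty, hence its
      absolute value.\<close>
    have C': "\<bar>H x\<bar> \<le> \<bar>C\<bar>" for x
      using C[of x] by (auto simp: H_def indicator_def)
    have pH: "(\<lambda>x. p x * H x) \<in> borel_measurable lborel"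
      using pm Hm by measurable
    have "integrable lborel (\<lambda>x. p x * H x)"
    proof (rule Bochner_Integration.integrable_bound)
      show "integrable lborel (\<lambda>x. \<bar>C\<bar> * p x)"
        using int by simp
      show "AE x in lborel. norm (p x * H x) \<le> norm (\<bar>C\<bar> * p x)"
        using C' by (auto simp: abs_mult mult.commute intro!: mult_right_mono)
    qed (rule pH)
    then have intL: "integrable lebesgue (\<lambda>x. p x * H x)"
      using pH by (simp add: integrable_completion)
    have QH: "(\<lambda>x. Q x * H x) \<in> borel_measurable lebesgue"
      using Qm measurable_completion[OF Hm] by measurable
    have ae2: "AE x in lebesgue. p x * H x = Q x * H x"
      using aeL by eventually_elim auto
    have QHint: "integrable lebesgue (\<lambda>x. Q x * H x)"
      using intL QH ae2 by (rule integrable_cong_AE_imp)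
    \<comment> \<open>The indicator hidden in \<open>Q\<close> is 1 on \<open>?A\<close>, because
      \<open>s <= b\<close> and \<open>t <= d\<close>.\<close>
    have "iterated_integral a s c t (\<lambda>y z. P y z * h y z) =
        (LINT y|lebesgue. LINT z|lebesgue. Q (y, z) * H (y, z))"
      unfolding iterated_integral_def set_lebesgue_integral_def
        integral_scaleR_right[symmetric] Q_def H_def
      using s t by (intro Bochner_Integration.integral_cong refl) (auto simp: indicator_def)
    also have "\<dots> = (LINT x|lebesgue. Q x * H x)"
      by (rule integral_lebesgue_prod[OF QHint])
    also have "\<dots> = (LINT x|lebesgue. p x * H x)"
      using ae2 by (intro integral_cong_AE QH measurable_completion[OF pH]) auto
    also have "\<dots> = (LINT x|lborel. p x * H x)"
      by (rule integral_completion[OF pH])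
    finally show ?thesis
      by (simp add: H_def)
  qed
  moreover have "p x = 0" if "x \<notin> ?B" for x
    using that by (simp add: p_def)
  ultimately show thesis
    using int that by blast
qed

section \<open>Peano kernels and Taylor's formula at the right end point\<close>

text \<open>A case distinction rather than a power of \<open>max 0 (u - v)\<close>: for \<open>n = 0\<close> the latter is 1 also when \<open>u < v\<close>.\<close>

definition peano_kernel :: "nat \<Rightarrow> real \<Rightarrow> real \<Rightarrow> real" where
  "peano_kernel n u v = (if v \<le> u then (u - v) ^ n / fact n else 0)"

lemma peano_kernel_measurable [measurable (raw)]:
  assumes [measurable]: "f \<in> borel_measurable M" "g \<in> borel_measurable M"
  shows "(\<lambda>x. peano_kernel n (f x) (g x)) \<in> borel_measurable M"
  unfolding peano_kernel_def by measurable

lemma peano_kernel_bounds: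
  assumes "u \<in> {a..b}" "v \<in> {a..b}"
  shows "\<bar>peano_kernel n u v\<bar> \<le> (b - a) ^ n"
proof (cases "v \<le> u")
  case True
  have "(u - v) ^ n / fact n \<le> (u - v) ^ n / 1"
    using True by (intro divide_left_mono) auto
  also have "\<dots> \<le> (b - a) ^ n"
    using True assms by (auto intro: power_mono)
  finally show ?thesis
    using True by (simp add: peano_kernel_def)
qed (use assms in \<open>auto simp: peano_kernel_def\<close>)

text \<open>Expansion about \<open>b\<close> produces exactly the powers of \<open>b - y\<close>
  that occur in the moment conditions. It follows from the expansion about a left end point by the
  reflection \<open>x = -u\<close>, which is the source of the alternating signs.\<close>

lemma Taylor_right_endpoint:
  fixes \<phi> :: "nat \<Rightarrow> real \<Rightarrow> real"
  assumes deriv: "\<And>i x. i \<le> n \<Longrightarrow> x \<in> {a..b} \<Longrightarrow>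
      (\<phi> i has_real_derivative \<phi> (Suc i) x) (at x within {a..b})"
    and cont: "continuous_on {a..b} (\<phi> (Suc n))"
    and y: "y \<in> {a..b}"
  shows "\<phi> 0 y = (\<Sum>i\<le>n. (- 1) ^ i * \<phi> i b * ((b - y) ^ i / fact i)) +
      (- 1) ^ Suc n * (LINT u|lborel. indicator {a..b} u * \<phi> (Suc n) u * peano_kernel n u y)"
proof -
  define \<psi> where "\<psi> = (\<lambda>i x. (- 1) ^ i * \<phi> i (- x))"
  have d: "(\<psi> i has_vector_derivative \<psi> (Suc i) t) (at t within {-b..-y})"
    if "i < Suc n" "-b \<le> t" "t \<le> -y" for i t
  proof -
    have "-t \<in> {a..b}"
      using that y by auto
    then have "(\<phi> i has_real_derivative \<phi> (Suc i) (-t)) (at (-t) within {a..b})"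
      using that by (intro deriv) auto
    \<comment> \<open>The chain rule needs the derivative within the reflected interval, which is
      \<open>{y..b}\<close>, a subset of \<open>{a..b}\<close>.\<close>
    then have "(\<phi> i has_real_derivative \<phi> (Suc i) (-t)) (at (-t) within uminus ` {-b..-y})"
      by (rule DERIV_subset) (use y in auto)
    then have "((\<lambda>x. \<phi> i (- x)) has_real_derivative \<phi> (Suc i) (-t) * (-1)) (at t within {-b..-y})"
      by (rule DERIV_image_chain[unfolded comp_def]) (auto intro!: derivative_eq_intros)
    then show ?thesis
      unfolding \<psi>_def has_real_derivative_iff_has_vector_derivative[symmetric]
      by (auto intro!: derivative_eq_intros)
  qed
  have ba: "- b \<le> - y"
    using y by auto
  have "((\<lambda>x. ((- y - x) ^ (Suc n - 1) / fact (Suc n - 1)) *\<^sub>R \<psi> (Suc n) x) has_integral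
      \<psi> 0 (- y) - (\<Sum>i<Suc n. ((- y - - b) ^ i / fact i) *\<^sub>R \<psi> i (- b))) {-b..-y}"
    by (rule Taylor_has_integral[where Df = \<psi> and f = "\<psi> 0"]) (use d ba in auto)
  \<comment> \<open>Writing the integrand as a function of \<open>-x\<close> lets the reflection
    rule for integrals turn \<open>{-b..-y}\<close> into \<open>{y..b}\<close>.\<close>
  moreover have "((- y - x) ^ (Suc n - 1) / fact (Suc n - 1)) *\<^sub>R \<psi> (Suc n) x =
      (\<lambda>u. (u - y) ^ n / fact n * ((- 1) ^ Suc n * \<phi> (Suc n) u)) (- x)" for x
  proof -
    have "- y - x = - x - y"
      by simp
    then show ?thesis
      by (simp only: \<psi>_def real_scaleR_def diff_Suc_1)
  qed
  ultimately have "((\<lambda>x. (\<lambda>u. (u - y) ^ n / fact n * ((- 1) ^ Suc n * \<phi> (Suc n) u)) (- x)) has_integral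
      \<psi> 0 (- y) - (\<Sum>i<Suc n. ((- y - - b) ^ i / fact i) *\<^sub>R \<psi> i (- b))) {-b..-y}"
    by (simp only:)
  then have "((\<lambda>u. (u - y) ^ n / fact n * ((- 1) ^ Suc n * \<phi> (Suc n) u)) has_integral
      \<psi> 0 (- y) - (\<Sum>i<Suc n. ((- y - - b) ^ i / fact i) *\<^sub>R \<psi> i (- b))) {y..b}"
    by (subst (asm) has_integral_reflect_real)
  then have 1: "((\<lambda>u. (u - y) ^ n / fact n * ((- 1) ^ Suc n * \<phi> (Suc n) u)) has_integral
      \<phi> 0 y - (\<Sum>i\<le>n. (b - y) ^ i / fact i * ((- 1) ^ i * \<phi> i b))) {y..b}"
    by (simp add: \<psi>_def lessThan_Suc_atMost)
  \<comment> \<open>Continuity identifies the gauge integral of the remainder with its Lebesgue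
    integral, which Fubini's theorem requires later.\<close>
  have cont': "continuous_on {y..b} (\<lambda>u. (u - y) ^ n / fact n * \<phi> (Suc n) u)"
    by (intro continuous_intros continuous_on_subset[OF cont]) (use y in auto)
  have "set_integrable lborel {y..b} (\<lambda>u. (u - y) ^ n / fact n * \<phi> (Suc n) u)"
    by (rule borel_integrable_atLeastAtMost'[OF cont'])
  then have "((\<lambda>u. (u - y) ^ n / fact n * \<phi> (Suc n) u) has_integral
      (LINT u:{y..b}|lborel. (u - y) ^ n / fact n * \<phi> (Suc n) u)) {y..b}"
    using set_borel_integral_eq_integral integrable_integral by metis
  then have "((\<lambda>u. (- 1) ^ Suc n * ((u - y) ^ n / fact n * \<phi> (Suc n) u)) has_integral
      (- 1) ^ Suc n * (LINT u:{y..b}|lborel. (u - y) ^ n / fact n * \<phi> (Suc n) u)) {y..b}"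
    by (rule has_integral_mult_right)
  then have "\<phi> 0 y - (\<Sum>i\<le>n. (b - y) ^ i / fact i * ((- 1) ^ i * \<phi> i b)) =
      (- 1) ^ Suc n * (LINT u:{y..b}|lborel. (u - y) ^ n / fact n * \<phi> (Suc n) u)"
    using 1 by (intro has_integral_unique[OF 1]) (simp add: algebra_simps)
  \<comment> \<open>The truncation in the kernel makes the domain of integration independent of
    \<open>y\<close>.\<close>
  moreover have "(LINT u:{y..b}|lborel. (u - y) ^ n / fact n * \<phi> (Suc n) u) =
      (LINT u|lborel. indicator {a..b} u * \<phi> (Suc n) u * peano_kernel n u y)"
    unfolding set_lebesgue_integral_def
    using y by (intro Bochner_Integration.integral_cong refl) (auto simp: indicator_def peano_kernel_def)
  ultimately have "\<phi> 0 y - (\<Sum>i\<le>n. (b - y) ^ i / fact i * ((- 1) ^ i * \<phi> i b)) =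
      (- 1) ^ Suc n * (LINT u|lborel. indicator {a..b} u * \<phi> (Suc n) u * peano_kernel n u y)"
    by (simp only:)
  moreover have "(\<Sum>i\<le>n. (b - y) ^ i / fact i * ((- 1) ^ i * \<phi> i b)) =
      (\<Sum>i\<le>n. (- 1) ^ i * \<phi> i b * ((b - y) ^ i / fact i))"
    by (simp only: mult.commute)
  ultimately show ?thesis
    by linarith
qed

section \<open>Taylor's formula integrated against a weight\<close>

text \<open>The function is dominated by \<open>C * indicator A t * p x\<close>, a product of
  integrable functions of separate variables. The bound on \<open>K\<close> is asked only where
  \<open>p x\<close> is nonzero: the kernel used for \<open>T\<close> below need not be bounded when
  \<open>x\<close> leaves the rectangle carrying \<open>p\<close>.\<close>

lemma integrable_prod_dominated:
  fixes p :: "'a::euclidean_space \<Rightarrow> real" and K :: "'b::euclidean_space \<times> 'a \<Rightarrow> real"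
  assumes p: "integrable lborel p"
    and K: "K \<in> borel_measurable borel"
    and A: "A \<in> sets borel" "emeasure lborel A < \<infinity>"
    and bound: "\<And>t x. p x \<noteq> 0 \<Longrightarrow> \<bar>K (t, x)\<bar> \<le> C * indicator A t"
  shows "integrable (lborel \<Otimes>\<^sub>M lborel) (\<lambda>(t, x). p x * K (t, x))"
proof (rule Bochner_Integration.integrable_bound)
  have [measurable]: "p \<in> borel_measurable borel"
    using p by auto
  have [measurable]: "A \<in> sets borel"
    by (rule A)
  have [measurable]: "K \<in> borel_measurable (borel \<Otimes>\<^sub>M borel)"
    using K by (simp add: borel_prod)
  have iA: "integrable lborel (indicator A :: 'b \<Rightarrow> real)"
    using A by simp
  have "integrable (lborel \<Otimes>\<^sub>M lborel) (\<lambda>(t, x). indicator A t * p x)"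
  proof (rule lborel_pair.Fubini_integrable)
    show "(\<lambda>(t, x). indicator A t * p x) \<in> borel_measurable (lborel \<Otimes>\<^sub>M lborel)"
      by measurable
    show "integrable lborel (\<lambda>t. LINT x|lborel. norm (case (t, x) of (t, x) \<Rightarrow> indicator A t * p x))"
      using iA by (simp add: abs_mult)
    show "AE t in lborel. integrable lborel (\<lambda>x. case (t, x) of (t, x) \<Rightarrow> indicator A t * p x)"
      using p by simp
  qed
  then show "integrable (lborel \<Otimes>\<^sub>M lborel) (\<lambda>tx. C * (case tx of (t, x) \<Rightarrow> indicator A t * p x))"
    by simp
  show "(\<lambda>(t, x). p x * K (t, x)) \<in> borel_measurable (lborel \<Otimes>\<^sub>M lborel)"
    by measurable
  show "AE tx in lborel \<Otimes>\<^sub>M lborel. norm (case tx of (t, x) \<Rightarrow> p x * K (t, x))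
      \<le> norm (C * (case tx of (t, x) \<Rightarrow> indicator A t * p x))"
  proof (intro AE_I2)
    fix tx :: "'b \<times> 'a"
    obtain t x where tx: "tx = (t, x)"
      by force
    show "norm (case tx of (t, x) \<Rightarrow> p x * K (t, x))
      \<le> norm (C * (case tx of (t, x) \<Rightarrow> indicator A t * p x))"
    proof (cases "p x = 0")
      case False
      have "\<bar>p x\<bar> * \<bar>K (t, x)\<bar> \<le> \<bar>p x\<bar> * \<bar>C * indicator A t\<bar>"
        using bound[OF False, of t] by (intro mult_left_mono) auto
      then show ?thesis
        by (simp add: tx abs_mult ac_simps)
    qed (simp add: tx)
  qed
qed

lemma integrable_mult_continuous_on_compact:
  fixes q h :: "'a::euclidean_space \<Rightarrow> real"
  assumes q: "integrable lborel q" and q0: "\<And>x. x \<notin> B \<Longrightarrow> q x = 0"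
    and B: "compact B" and h: "continuous_on B h"
  shows "integrable lborel (\<lambda>x. q x * h x)"
proof -
  have Bm: "B \<in> sets borel"
    using B by (simp add: borel_compact)
  have [measurable]: "q \<in> borel_measurable borel"
    using q by auto
  have [measurable]: "(\<lambda>x. indicator B x * h x) \<in> borel_measurable borel"
    using borel_measurable_continuous_on_indicator[OF Bm h] by simp
  obtain C where C: "\<And>x. x \<in> B \<Longrightarrow> \<bar>h x\<bar> \<le> C"
    using compact_imp_bounded[OF compact_continuous_image[OF h B]] unfolding bounded_iff by auto
  \<comment> \<open>Outside \<open>B\<close> nothing is known about \<open>h\<close>, not even
    measurability; cutting it off does not change the product.\<close>
  have eq: "q x * h x = q x * (indicator B x * h x)" for x
    using q0[of x] by (cases "x \<in> B") auto
  show ?thesis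
    unfolding eq
  proof (rule Bochner_Integration.integrable_bound)
    show "integrable lborel (\<lambda>x. C * q x)"
      using q by simp
    show "AE x in lborel. norm (q x * (indicator B x * h x)) \<le> norm (C * q x)"
    proof (intro AE_I2)
      fix x
      show "norm (q x * (indicator B x * h x)) \<le> norm (C * q x)"
        using C[of x] by (auto simp: indicator_def abs_mult mult.commute intro!: mult_right_mono)
    qed
  qed measurable
qed

text \<open>The formula for \<phi>\<open>x\<close> at the point \<open>v x\<close> is multiplied by
  \<open>q x\<close> and integrated, and Fubini's theorem moves the integral over \<open>x\<close>
  inside the remainder. Keeping the point \<open>x\<close> apart from the expanded coordinate
  \<open>v x\<close> lets the lemma serve both for \<open>v = snd\<close>, with the other coordinate
  as a parameter, and for \<open>v = fst\<close>.\<close>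

lemma integral_Taylor_right_endpoint:
  fixes q v :: "'a::euclidean_space \<Rightarrow> real" and \<phi> :: "'a \<Rightarrow> nat \<Rightarrow> real \<Rightarrow> real"
  assumes q: "integrable lborel q" and q0: "\<And>x. x \<notin> B \<Longrightarrow> q x = 0"
    and B: "compact B" and v: "continuous_on B v" "v ` B \<subseteq> {a..b}"
    and deriv: "\<And>x i u. x \<in> B \<Longrightarrow> i \<le> n \<Longrightarrow> u \<in> {a..b} \<Longrightarrow>
      (\<phi> x i has_real_derivative \<phi> x (Suc i) u) (at u within {a..b})"
    and cont_b: "\<And>i. i \<le> n \<Longrightarrow> continuous_on B (\<lambda>x. \<phi> x i b)"
    and cont: "continuous_on ({a..b} \<times> B) (\<lambda>(u, x). \<phi> x (Suc n) u)"
  shows "(LINT x|lborel. q x * \<phi> x 0 (v x)) =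
      (\<Sum>i\<le>n. (- 1) ^ i * (LINT x|lborel. q x * \<phi> x i b * ((b - v x) ^ i / fact i))) +
      (- 1) ^ Suc n * (LINT u|lborel. indicator {a..b} u *
        (LINT x|lborel. q x * \<phi> x (Suc n) u * peano_kernel n u (v x)))"
proof -
  have Bm [measurable]: "B \<in> sets borel"
    using B by (simp add: borel_compact)
  let ?S = "{a..b} \<times> B"
  have Sc: "compact ?S"
    using B by (intro compact_Times compact_Icc)
  then have Sm: "?S \<in> sets borel"
    by (simp add: borel_compact)
  have vm [measurable]: "(\<lambda>x. indicator B x * v x) \<in> borel_measurable borel"
    using borel_measurable_continuous_on_indicator[OF Bm v(1)] by simp
  \<comment> \<open>Both indicators serve joint Borel measurability on the whole space, as \<phi>
    and \<open>v\<close> are continuous only over \<open>B\<close>.\<close>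
  define K where "K = (\<lambda>(u, x). indicator ?S (u, x) * \<phi> x (Suc n) u *
      peano_kernel n u (indicator B x * v x))"
  have [measurable]: "(\<lambda>(u, x). indicator ?S (u, x) * \<phi> x (Suc n) u) \<in> borel_measurable (borel \<Otimes>\<^sub>M borel)"
    using borel_measurable_continuous_on_indicator[OF Sm cont] by (simp add: borel_prod case_prod_unfold)
  have Km: "K \<in> borel_measurable borel"
    unfolding K_def borel_prod[symmetric] by measurable
  obtain C where C: "\<And>u x. u \<in> {a..b} \<Longrightarrow> x \<in> B \<Longrightarrow> \<bar>\<phi> x (Suc n) u\<bar> \<le> C"
    using compact_imp_bounded[OF compact_continuous_image[OF cont Sc]] unfolding bounded_iff by fastforce
  have bound: "\<bar>K (u, x)\<bar> \<le> C * (b - a) ^ n * indicator {a..b} u" if "q x \<noteq> 0" for u x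
  proof (cases "u \<in> {a..b}")
    case True
    have x: "x \<in> B"
      using q0 that by blast
    then have "\<bar>peano_kernel n u (v x)\<bar> \<le> (b - a) ^ n"
      using True v(2) by (intro peano_kernel_bounds) auto
    moreover have "0 \<le> C"
      using C[OF True x] by linarith
    ultimately show ?thesis
      using C[OF True x] True x by (auto simp: K_def abs_mult intro!: mult_mono)
  qed (auto simp: K_def)
  \<comment> \<open>This yields both the integrability in \<open>x\<close> of the remainder and the
    exchange of the two integrals.\<close>
  have int: "integrable (lborel \<Otimes>\<^sub>M lborel) (\<lambda>(u, x). q x * K (u, x))"
    by (rule integrable_prod_dominated[OF q Km _ _ bound]) (auto simp: emeasure_lborel_Icc_eq)
  have intx: "integrable lborel (\<lambda>x. LINT u|lborel. q x * K (u, x))"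
    using lborel_pair.integrable_snd[OF int] .
  have int_i: "integrable lborel (\<lambda>x. q x * \<phi> x i b * ((b - v x) ^ i / fact i))" if "i \<le> n" for i
  proof -
    have "integrable lborel (\<lambda>x. q x * (\<phi> x i b * ((b - v x) ^ i / fact i)))"
      using that by (intro integrable_mult_continuous_on_compact[OF q q0 B] continuous_intros v cont_b) auto
    then show ?thesis
      by (simp add: mult.assoc)
  qed
  have "q x * \<phi> x 0 (v x) = (\<Sum>i\<le>n. (- 1) ^ i * (q x * \<phi> x i b * ((b - v x) ^ i / fact i))) +
      (- 1) ^ Suc n * (LINT u|lborel. q x * K (u, x))" for x
  proof (cases "x \<in> B")
    case True
    have "continuous_on {a..b} (\<lambda>u. case (u, x) of (u, x) \<Rightarrow> \<phi> x (Suc n) u)"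
      by (rule continuous_on_compose2[OF cont]) (use True in \<open>auto intro!: continuous_intros\<close>)
    then have T: "\<phi> x 0 (v x) = (\<Sum>i\<le>n. (- 1) ^ i * \<phi> x i b * ((b - v x) ^ i / fact i)) +
      (- 1) ^ Suc n * (LINT u|lborel. indicator {a..b} u * \<phi> x (Suc n) u * peano_kernel n u (v x))"
      using True v(2) deriv by (intro Taylor_right_endpoint) auto
    have I: "(LINT u|lborel. q x * K (u, x)) =
        q x * (LINT u|lborel. indicator {a..b} u * \<phi> x (Suc n) u * peano_kernel n u (v x))"
      unfolding K_def using True by (simp add: indicator_times)
    then show ?thesis
      unfolding T I by (simp add: ring_distribs sum_distrib_left mult.commute mult.left_commute)
  qed (simp add: q0)
  then have "(LINT x|lborel. q x * \<phi> x 0 (v x)) =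
      (LINT x|lborel. (\<Sum>i\<le>n. (- 1) ^ i * (q x * \<phi> x i b * ((b - v x) ^ i / fact i))) +
      (- 1) ^ Suc n * (LINT u|lborel. q x * K (u, x)))"
    by simp
  also have "\<dots> = (LINT x|lborel. (\<Sum>i\<le>n. (- 1) ^ i * (q x * \<phi> x i b * ((b - v x) ^ i / fact i)))) +
      (LINT x|lborel. (- 1) ^ Suc n * (LINT u|lborel. q x * K (u, x)))"
    by (intro Bochner_Integration.integral_add Bochner_Integration.integrable_sum
        integrable_mult_right int_i intx) simp
  finally have expand: "(LINT x|lborel. q x * \<phi> x 0 (v x)) =
      (LINT x|lborel. (\<Sum>i\<le>n. (- 1) ^ i * (q x * \<phi> x i b * ((b - v x) ^ i / fact i)))) +
      (LINT x|lborel. (- 1) ^ Suc n * (LINT u|lborel. q x * K (u, x)))" .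
  have sums: "(LINT x|lborel. (\<Sum>i\<le>n. (- 1) ^ i * (q x * \<phi> x i b * ((b - v x) ^ i / fact i)))) =
      (\<Sum>i\<le>n. (LINT x|lborel. (- 1) ^ i * (q x * \<phi> x i b * ((b - v x) ^ i / fact i))))"
    by (intro Bochner_Integration.integral_sum integrable_mult_right int_i) simp
  have "(LINT x|lborel. LINT u|lborel. q x * K (u, x)) = (LINT u|lborel. LINT x|lborel. q x * K (u, x))"
    using lborel_pair.Fubini_integral[OF int] .
  also have "\<dots> = (LINT u|lborel. indicator {a..b} u *
        (LINT x|lborel. q x * \<phi> x (Suc n) u * peano_kernel n u (v x)))"
    unfolding integral_mult_right_zero[symmetric]
  proof (intro Bochner_Integration.integral_cong refl)
    fix u x
    show "q x * K (u, x) = indicator {a..b} u * (q x * \<phi> x (Suc n) u * peano_kernel n u (v x))"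
      using q0[of x] by (auto simp: K_def indicator_def)
  qed
  finally show ?thesis
    unfolding expand sums integral_mult_right_zero by (rule arg_cong)
qed

section \<open>Partial derivatives and expansion in the first variable\<close>

text \<open>The first order is 0 because \<open>C_on\<close> grants differentiability in
  \<open>z\<close> only before any differentiation in \<open>y\<close>. This dictates the order of
  the two Taylor expansions.\<close>

lemma has_real_derivative_partial_deriv_snd:
  assumes "C_on m n I J f" "j < n" "y \<in> I" "z \<in> J"
  shows "(partial_deriv I J 0 j f y has_real_derivative partial_deriv I J 0 (Suc j) f y z)
    (at z within J)"
proof -
  have "(\<lambda>v. partial_deriv I J 0 j f y v) differentiable (at z within J)"
    using assms unfolding C_on_def by blast
  then show ?thesis
    by (simp add: has_real_derivative_iff_has_vector_derivative vector_derivative_works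
        partial_deriv_def deriv_snd_def)
qed

lemma has_real_derivative_partial_deriv_fst:
  assumes "C_on m n I J f" "i < m" "j \<le> n" "y \<in> I" "z \<in> J"
  shows "((\<lambda>u. partial_deriv I J i j f u z) has_real_derivative partial_deriv I J (Suc i) j f y z)
    (at y within I)"
proof -
  have "(\<lambda>u. partial_deriv I J i j f u z) differentiable (at y within I)"
    using assms unfolding C_on_def by blast
  then show ?thesis
    by (simp add: has_real_derivative_iff_has_vector_derivative vector_derivative_works
        partial_deriv_def deriv_fst_def)
qed

lemma continuous_on_partial_deriv:
  assumes "C_on m n I J f" "i \<le> m" "j \<le> n"
    and "continuous_on S g" "continuous_on S h" "g ` S \<subseteq> I" "h ` S \<subseteq> J"
  shows "continuous_on S (\<lambda>x. partial_deriv I J i j f (g x) (h x))"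
proof -
  have "continuous_on (I \<times> J) (\<lambda>(y, z). partial_deriv I J i j f y z)"
    using assms unfolding C_on_def by blast
  then have "continuous_on S (\<lambda>x. case (g x, h x) of (y, z) \<Rightarrow> partial_deriv I J i j f y z)"
    by (rule continuous_on_compose2) (use assms in \<open>auto intro!: continuous_intros\<close>)
  then show ?thesis
    by simp
qed

text \<open>The expansion in \<open>y\<close> with \<open>z\<close> frozen at \<open>t\<close>: the
  derivatives at \<open>(b, t)\<close> and at \<open>(s, t)\<close> do not depend on
  \<open>x\<close> and leave the integral, so the moments of \<open>q\<close> remove the boundary
  terms. It is used with \<open>q\<close> equal to \<open>p\<close> times a power of
  \<open>d - z\<close>, and to \<open>p\<close> times a kernel in \<open>z\<close>.\<close>

lemma integral_partial_deriv_fst: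
  fixes q :: "real \<times> real \<Rightarrow> real"
  assumes q: "integrable lborel q" and q0: "\<And>x. x \<notin> {a..b} \<times> {c..d} \<Longrightarrow> q x = 0"
    and f: "C_on (Suc M) n {a..b} {c..d} f" and ab: "a \<le> b" and t: "t \<in> {c..d}" and j: "j \<le> n"
    and moments: "\<And>i. i \<le> M \<Longrightarrow> (LINT x|lborel. q x * ((b - fst x) ^ i / fact i)) = 0"
  shows "(LINT x|lborel. q x * partial_deriv {a..b} {c..d} 0 j f (fst x) t) =
    (- 1) ^ Suc M * (LINT s|lborel. indicator {a..b} s * partial_deriv {a..b} {c..d} (Suc M) j f s t *
      (LINT x|lborel. q x * peano_kernel M s (fst x)))"
proof -
  let ?D = "\<lambda>i. partial_deriv {a..b} {c..d} i j f"
  have "(LINT x|lborel. q x * ?D 0 (fst x) t) =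
      (\<Sum>i\<le>M. (- 1) ^ i * (LINT x|lborel. q x * ?D i b t * ((b - fst x) ^ i / fact i))) +
      (- 1) ^ Suc M * (LINT s|lborel. indicator {a..b} s *
        (LINT x|lborel. q x * ?D (Suc M) s t * peano_kernel M s (fst x)))"
  proof (rule integral_Taylor_right_endpoint[OF q q0, where v = fst and \<phi> = "\<lambda>x i s. ?D i s t"])
    show "compact ({a..b} \<times> {c..d})"
      by (intro compact_Times compact_Icc)
    show "continuous_on ({a..b} \<times> {a..b} \<times> {c..d}) (\<lambda>(u, x). ?D (Suc M) u t)"
      unfolding case_prod_unfold
      by (rule continuous_on_partial_deriv[OF f]) (use t j in \<open>auto intro!: continuous_intros\<close>)
  qed (use has_real_derivative_partial_deriv_fst[OF f] t j in \<open>auto intro!: continuous_intros\<close>)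
  moreover have "(LINT x|lborel. q x * ?D i b t * ((b - fst x) ^ i / fact i)) = 0" if "i \<le> M" for i
  proof -
    have "(LINT x|lborel. q x * ?D i b t * ((b - fst x) ^ i / fact i)) =
        (LINT x|lborel. ?D i b t * (q x * ((b - fst x) ^ i / fact i)))"
      by (simp only: mult.commute mult.left_commute)
    also have "\<dots> = 0"
      using moments[OF that] by (simp only: integral_mult_right_zero)
    finally show ?thesis .
  qed
  moreover have "(LINT x|lborel. q x * ?D (Suc M) s t * peano_kernel M s (fst x)) =
      ?D (Suc M) s t * (LINT x|lborel. q x * peano_kernel M s (fst x))" for s
    unfolding integral_mult_right_zero[symmetric] by (simp only: mult.assoc mult.commute mult.left_commute)
  ultimately show ?thesis
    by (simp add: mult.assoc)
qed

section \<open>A weighted mean value theorem for quotients\<close>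

text \<open>For positive \<open>G\<close> the quotient of the integrals is the average of
  \<open>F / G\<close> with respect to the weight \<open>T * G\<close>. It therefore lies between
  the extrema of \<open>F / G\<close> over \<open>K\<close>, and connectedness supplies a point
  where it is attained.\<close>

lemma integral_ratio_eq_ratio:
  fixes T F G :: "'a::euclidean_space \<Rightarrow> real"
  assumes T: "integrable lborel T" and T_nonneg: "\<And>x. 0 \<le> T x" and T0: "\<And>x. x \<notin> K \<Longrightarrow> T x = 0"
    and K: "compact K" "connected K" "K \<noteq> {}"
    and F: "continuous_on K F" and G: "continuous_on K G" and G0: "\<And>x. x \<in> K \<Longrightarrow> G x \<noteq> 0"
    and nz: "(LINT x|lborel. T x * G x) \<noteq> 0"
  shows "\<exists>x\<in>K. (LINT x|lborel. T x * F x) / (LINT x|lborel. T x * G x) = F x / G x"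
proof -
  have pos: "\<exists>x\<in>K. (LINT x|lborel. T x * F x) / (LINT x|lborel. T x * G x) = F x / G x"
    if F: "continuous_on K F" and G: "continuous_on K G" and G_pos: "\<And>x. x \<in> K \<Longrightarrow> 0 < G x"
      and nz: "(LINT x|lborel. T x * G x) \<noteq> 0" for F G
  proof -
    let ?R = "\<lambda>x. F x / G x"
    have R: "continuous_on K ?R"
      using F G G_pos by (intro continuous_on_divide) (auto simp: less_imp_neq[symmetric])
    obtain x1 where x1: "x1 \<in> K" "\<And>x. x \<in> K \<Longrightarrow> ?R x1 \<le> ?R x"
      using continuous_attains_inf[OF K(1,3) R] by blast
    obtain x2 where x2: "x2 \<in> K" "\<And>x. x \<in> K \<Longrightarrow> ?R x \<le> ?R x2"
      using continuous_attains_sup[OF K(1,3) R] by blast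
    have TF: "integrable lborel (\<lambda>x. T x * F x)" and TG: "integrable lborel (\<lambda>x. T x * G x)"
      using integrable_mult_continuous_on_compact[OF T T0 K(1)] F G by auto
    have "0 \<le> T x * G x" for x
      using T_nonneg[of x] T0[of x] G_pos[of x] by (cases "x \<in> K") auto
    then have "0 \<le> (LINT x|lborel. T x * G x)"
      by (rule Bochner_Integration.integral_nonneg)
    with nz have TG_pos: "0 < (LINT x|lborel. T x * G x)"
      by simp
    have "(LINT x|lborel. ?R x1 * (T x * G x)) \<le> (LINT x|lborel. T x * F x)"
    proof (rule integral_mono[OF integrable_mult_right[OF TG] TF])
      fix x
      show "?R x1 * (T x * G x) \<le> T x * F x"
      proof (cases "x \<in> K")
        case True
        then have "?R x1 * G x \<le> F x"
          using x1(2)[OF True] G_pos[OF True] by (simp only: pos_le_divide_eq)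
        then show ?thesis
          using mult_left_mono[OF _ T_nonneg[of x]] by (metis mult.left_commute)
      qed (simp add: T0)
    qed
    then have low: "?R x1 \<le> (LINT x|lborel. T x * F x) / (LINT x|lborel. T x * G x)"
      using TG_pos by (simp only: pos_le_divide_eq integral_mult_right_zero)
    have "(LINT x|lborel. T x * F x) \<le> (LINT x|lborel. ?R x2 * (T x * G x))"
    proof (rule integral_mono[OF TF integrable_mult_right[OF TG]])
      fix x
      show "T x * F x \<le> ?R x2 * (T x * G x)"
      proof (cases "x \<in> K")
        case True
        then have "F x \<le> ?R x2 * G x"
          using x2(2)[OF True] G_pos[OF True] by (simp only: pos_divide_le_eq)
        then show ?thesis
          using mult_left_mono[OF _ T_nonneg[of x]] by (metis mult.left_commute)
      qed (simp add: T0)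
    qed
    then have high: "(LINT x|lborel. T x * F x) / (LINT x|lborel. T x * G x) \<le> ?R x2"
      using TG_pos by (simp only: pos_divide_le_eq integral_mult_right_zero)
    have "connected (?R ` K)"
      using R K(2) by (rule connected_continuous_image)
    then have "(LINT x|lborel. T x * F x) / (LINT x|lborel. T x * G x) \<in> ?R ` K"
      by (rule connectedD_interval) (use x1(1) x2(1) low high in auto)
    then show ?thesis
      by auto
  qed
  \<comment> \<open>Without zeros on a connected set, \<open>G\<close> has constant sign. In the
    negative case changing the sign of both \<open>F\<close> and \<open>G\<close> preserves both
    quotients.\<close>
  have "(\<forall>x\<in>K. 0 < G x) \<or> (\<forall>x\<in>K. 0 < - G x)"
  proof (rule ccontr)
    assume "\<not> ?thesis"
    then obtain x y where xy: "x \<in> K" "y \<in> K" "G x \<le> 0" "0 \<le> G y"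
      by (auto simp: not_less)
    have "connected (G ` K)"
      using G K(2) by (rule connected_continuous_image)
    then have "0 \<in> G ` K"
      by (rule connectedD_interval) (use xy in auto)
    then show False
      using G0 by auto
  qed
  then show ?thesis
  proof
    assume "\<forall>x\<in>K. 0 < G x"
    then show ?thesis
      using pos[OF F G _ nz] by blast
  next
    assume "\<forall>x\<in>K. 0 < - G x"
    then show ?thesis
      using pos[OF continuous_on_minus[OF F] continuous_on_minus[OF G]] nz by simp
  qed
qed

section \<open>Integral representation of the functional\<close>

text \<open>\<open>T\<close> is obtained before \<open>f\<close> is quantified, so numerator and
  denominator of the final quotient share one weight.\<close>

lemma Lambda_eq_integral_partial_deriv:
  assumes ab: "a \<le> b" and cd: "c \<le> d"
    and P: "set_integrable lebesgue ({a..b} \<times> {c..d}) (\<lambda>(y, z). P y z)"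
    and mom_bd: "\<forall>i\<in>{0..M}. \<forall>j\<in>{0..N}.
           iterated_integral a b c d
             (\<lambda>y z. P y z * ((b - y) ^ i / fact i) * ((d - z) ^ j / fact j)) = 0"
    and mom_d: "\<forall>j\<in>{0..N}. \<forall>s\<in>{a..b}.
           iterated_integral a s c d
             (\<lambda>y z. P y z * ((s - y) ^ M / fact M) * ((d - z) ^ j / fact j)) = 0"
    and mom_b: "\<forall>i\<in>{0..M}. \<forall>t\<in>{c..d}.
           iterated_integral a b c t
             (\<lambda>y z. P y z * ((b - y) ^ i / fact i) * ((t - z) ^ N / fact N)) = 0"
    and mom: "\<forall>s\<in>{a..b}. \<forall>t\<in>{c..d}.
           iterated_integral a s c t
             (\<lambda>y z. P y z * ((s - y) ^ M / fact M) * ((t - z) ^ N / fact N)) \<ge> 0"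
  obtains T :: "real \<times> real \<Rightarrow> real" where "integrable lborel T" and "\<And>x. 0 \<le> T x"
    and "\<And>x. x \<notin> {a..b} \<times> {c..d} \<Longrightarrow> T x = 0"
    and "\<And>f. C_on (M + 1) (N + 1) {a..b} {c..d} f \<Longrightarrow>
      Lambda a b c d P f = (- 1) ^ (M + N) * (LINT x|lborel. T x *
        partial_deriv {a..b} {c..d} (M + 1) (N + 1) f (fst x) (snd x))"
proof -
  let ?B = "{a..b} \<times> {c..d}"
  have Bc: "compact ?B"
    by (intro compact_Times compact_Icc)
  have Bm [measurable]: "?B \<in> sets borel"
    using Bc by (simp add: borel_compact)
  obtain p :: "real \<times> real \<Rightarrow> real" where p: "integrable lborel p"
    and p0: "\<And>x. x \<notin> ?B \<Longrightarrow> p x = 0"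
    and iter: "\<And>s t h. \<lbrakk>s \<le> b; t \<le> d; continuous_on ?B (\<lambda>(y, z). h y z)\<rbrakk> \<Longrightarrow>
      iterated_integral a s c t (\<lambda>y z. P y z * h y z) =
      (LINT x|lborel. p x * (indicator ({a..s} \<times> {c..t}) x * h (fst x) (snd x)))"
    using iterated_integral_eq_integral_lborel[OF P] by blast
  \<comment> \<open>\<open>k\<close> is the integrand in the shape wanted later; vanishing together
    with \<open>p\<close> settles the points outside the rectangle.\<close>
  have iter_eq: "iterated_integral a s c t (\<lambda>y z. P y z * g y * h z) = (LINT x|lborel. k x)"
    if "s \<le> b" "t \<le> d" "continuous_on {a..b} g" "continuous_on {c..d} h"
      and k: "\<And>x. x \<in> ?B \<Longrightarrow> k x = p x * (indicator ({a..s} \<times> {c..t}) x * (g (fst x) * h (snd x)))"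
      and k0: "\<And>x. p x = 0 \<Longrightarrow> k x = 0"
    for s t g h k
  proof -
    have "continuous_on ?B (\<lambda>(y, z). g y * h z)"
      unfolding case_prod_unfold
      by (intro continuous_on_mult continuous_on_compose2[OF that(3)] continuous_on_compose2[OF that(4)]
          continuous_intros) auto
    then have "iterated_integral a s c t (\<lambda>y z. P y z * (g y * h z)) =
        (LINT x|lborel. p x * (indicator ({a..s} \<times> {c..t}) x * (g (fst x) * h (snd x))))"
      using that by (intro iter) auto
    also have "\<dots> = (LINT x|lborel. k x)"
    proof (intro Bochner_Integration.integral_cong refl)
      fix x
      show "p x * (indicator ({a..s} \<times> {c..t}) x * (g (fst x) * h (snd x))) = k x"
        using k[of x] k0[of x] p0[of x] by (cases "x \<in> ?B") auto
    qed
    finally show ?thesis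
      by (simp add: mult.assoc)
  qed
  \<comment> \<open>In this and the next three facts the factor in \<open>z\<close> stands next to
    \<open>p\<close>, so that their product can be the weight \<open>q\<close> of
    \<open>integral_partial_deriv_fst\<close>. Truncation in \<open>peano_kernel\<close> absorbs the
    indicators of \<open>{a..s}\<close> and \<open>{c..t}\<close>, closed ends included.\<close>
  have p_bd: "(LINT x|lborel. p x * ((d - snd x) ^ j / fact j) * ((b - fst x) ^ i / fact i)) = 0"
    if "i \<le> M" "j \<le> N" for i j
  proof -
    have "iterated_integral a b c d (\<lambda>y z. P y z * ((b - y) ^ i / fact i) * ((d - z) ^ j / fact j)) =
        (LINT x|lborel. p x * ((d - snd x) ^ j / fact j) * ((b - fst x) ^ i / fact i))"
      by (rule iter_eq) (auto intro!: continuous_intros simp: indicator_def mult_ac)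
    then show ?thesis
      using mom_bd that by simp
  qed
  have p_d: "(LINT x|lborel. p x * ((d - snd x) ^ j / fact j) * peano_kernel M s (fst x)) = 0"
    if "s \<in> {a..b}" "j \<le> N" for s j
  proof -
    have "iterated_integral a s c d (\<lambda>y z. P y z * ((s - y) ^ M / fact M) * ((d - z) ^ j / fact j)) =
        (LINT x|lborel. p x * ((d - snd x) ^ j / fact j) * peano_kernel M s (fst x))"
      by (rule iter_eq) (use that in \<open>auto intro!: continuous_intros simp: indicator_def peano_kernel_def mult_ac\<close>)
    then show ?thesis
      using mom_d that by simp
  qed
  have p_b: "(LINT x|lborel. p x * peano_kernel N t (snd x) * ((b - fst x) ^ i / fact i)) = 0"
    if "i \<le> M" "t \<in> {c..d}" for i t
  proof -
    have "iterated_integral a b c t (\<lambda>y z. P y z * ((b - y) ^ i / fact i) * ((t - z) ^ N / fact N)) =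
        (LINT x|lborel. p x * peano_kernel N t (snd x) * ((b - fst x) ^ i / fact i))"
      by (rule iter_eq) (use that in \<open>auto intro!: continuous_intros simp: indicator_def peano_kernel_def mult_ac\<close>)
    then show ?thesis
      using mom_b that by simp
  qed
  have p_nonneg: "0 \<le> (LINT x|lborel. p x * peano_kernel N t (snd x) * peano_kernel M s (fst x))"
    if "s \<in> {a..b}" "t \<in> {c..d}" for s t
  proof -
    have "iterated_integral a s c t (\<lambda>y z. P y z * ((s - y) ^ M / fact M) * ((t - z) ^ N / fact N)) =
        (LINT x|lborel. p x * peano_kernel N t (snd x) * peano_kernel M s (fst x))"
      by (rule iter_eq) (use that in \<open>auto intro!: continuous_intros simp: indicator_def peano_kernel_def mult_ac\<close>)
    then show ?thesis
      using mom that by fastforce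
  qed
  have [measurable]: "p \<in> borel_measurable borel"
    using p by auto
  \<comment> \<open>The indicator is there because the sign of the integral is known only for
    \<open>(s, t)\<close> in the rectangle.\<close>
  define T where "T = (\<lambda>st. indicator ?B st *
      (LINT x|lborel. p x * peano_kernel N (snd st) (snd x) * peano_kernel M (fst st) (fst x)))"
  define K where "K = (\<lambda>(st, x). indicator ?B st *
      (peano_kernel N (snd st) (snd x) * peano_kernel M (fst st) (fst x)))"
  have [measurable]: "(fst :: real \<times> real \<Rightarrow> real) \<in> borel_measurable borel"
    "(snd :: real \<times> real \<Rightarrow> real) \<in> borel_measurable borel"
    by (simp_all add: borel_prod[symmetric])
  have Km: "K \<in> borel_measurable borel"
    unfolding K_def borel_prod[where 'a = "real \<times> real" and 'b = "real \<times> real", symmetric] by measurable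
  have K_bound: "\<bar>K (st, x)\<bar> \<le> ((d - c) ^ N * (b - a) ^ M) * indicator ?B st" if "p x \<noteq> 0" for st x
  proof (cases "st \<in> ?B")
    case True
    have "x \<in> ?B"
      using that p0 by blast
    then have "\<bar>peano_kernel N (snd st) (snd x)\<bar> \<le> (d - c) ^ N"
      "\<bar>peano_kernel M (fst st) (fst x)\<bar> \<le> (b - a) ^ M"
      using True by (auto intro!: peano_kernel_bounds)
    then show ?thesis
      using True cd by (simp add: K_def abs_mult mult_mono)
  qed (simp add: K_def)
  \<comment> \<open>\<open>T\<close> is a marginal of this function on the product of two planes,
    hence integrable.\<close>
  have "integrable (lborel \<Otimes>\<^sub>M lborel) (\<lambda>(st, x). p x * K (st, x))"
    by (rule integrable_prod_dominated[OF p Km Bm _ K_bound]) (use Bc emeasure_compact_finite in auto)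
  then have "integrable lborel (\<lambda>st. LINT x|lborel. p x * K (st, x))"
    by (rule lborel_pair.integrable_fst)
  also have "(\<lambda>st. LINT x|lborel. p x * K (st, x)) = T"
    unfolding T_def integral_mult_right_zero[symmetric] K_def
    by (simp add: mult.commute mult.left_commute)
  finally have T: "integrable lborel T" .
  have T_nonneg: "0 \<le> T x" for x
    using p_nonneg by (auto simp: T_def indicator_def)
  have T0: "T x = 0" if "x \<notin> ?B" for x
    using that by (simp add: T_def)
  have "Lambda a b c d P f = (- 1) ^ (M + N) * (LINT x|lborel. T x *
        partial_deriv {a..b} {c..d} (M + 1) (N + 1) f (fst x) (snd x))"
    if "C_on (M + 1) (N + 1) {a..b} {c..d} f" for f
  proof -
    have f: "C_on (Suc M) (Suc N) {a..b} {c..d} f"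
      using that by simp
    let ?D = "\<lambda>i j. partial_deriv {a..b} {c..d} i j f"
    have f0: "?D 0 0 = f"
      by (simp add: partial_deriv_def)
    have "continuous_on ?B (\<lambda>x. ?D 0 0 (fst x) (snd x))"
      by (rule continuous_on_partial_deriv[OF f]) (auto intro!: continuous_intros)
    then have "Lambda a b c d P f = (LINT x|lborel. p x * (indicator ?B x * f (fst x) (snd x)))"
      unfolding Lambda_def f0 by (intro iter) (auto simp: case_prod_unfold)
    also have "\<dots> = (LINT x|lborel. p x * ?D 0 0 (fst x) (snd x))"
    proof (intro Bochner_Integration.integral_cong refl)
      fix x
      show "p x * (indicator ?B x * f (fst x) (snd x)) = p x * ?D 0 0 (fst x) (snd x)"
        using p0[of x] by (cases "x \<in> ?B") (auto simp: f0)
    qed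
    also have "\<dots> = (\<Sum>j\<le>N. (- 1) ^ j * (LINT x|lborel. p x * ?D 0 j (fst x) d * ((d - snd x) ^ j / fact j))) +
      (- 1) ^ Suc N * (LINT t|lborel. indicator {c..d} t *
        (LINT x|lborel. p x * ?D 0 (Suc N) (fst x) t * peano_kernel N t (snd x)))"
    proof (rule integral_Taylor_right_endpoint[OF p p0 Bc, where v = snd and \<phi> = "\<lambda>x j t. ?D 0 j (fst x) t"])
      show "continuous_on ({c..d} \<times> ?B) (\<lambda>(t, x). ?D 0 (Suc N) (fst x) t)"
        unfolding case_prod_unfold
        by (rule continuous_on_partial_deriv[OF f]) (auto intro!: continuous_intros)
      show "continuous_on ?B (\<lambda>x. ?D 0 j (fst x) d)" if "j \<le> N" for j
        by (rule continuous_on_partial_deriv[OF f]) (use that cd in \<open>auto intro!: continuous_intros\<close>)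
    qed (use has_real_derivative_partial_deriv_snd[OF f] in \<open>auto intro!: continuous_intros\<close>)
    \<comment> \<open>Each boundary term of the expansion in \<open>z\<close> is expanded in
      \<open>y\<close> along \<open>z = d\<close>: \<open>p_bd\<close> removes its boundary terms
      and \<open>p_d\<close> its remainder.\<close>
    also have "(\<Sum>j\<le>N. (- 1) ^ j * (LINT x|lborel. p x * ?D 0 j (fst x) d * ((d - snd x) ^ j / fact j))) = 0"
    proof (intro sum.neutral ballI)
      fix j assume "j \<in> {..N}"
      then have j: "j \<le> N"
        by simp
      have "integrable lborel (\<lambda>x. p x * ((d - snd x) ^ j / fact j))"
        by (intro integrable_mult_continuous_on_compact[OF p p0 Bc] continuous_intros) auto
      then have "(LINT x|lborel. p x * ((d - snd x) ^ j / fact j) * ?D 0 j (fst x) d) =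
          (- 1) ^ Suc M * (LINT s|lborel. indicator {a..b} s * ?D (Suc M) j s d *
            (LINT x|lborel. p x * ((d - snd x) ^ j / fact j) * peano_kernel M s (fst x)))"
        by (rule integral_partial_deriv_fst[OF _ _ f ab]) (use j cd p0 p_bd in auto)
      also have "(\<lambda>s. indicator {a..b} s * ?D (Suc M) j s d *
            (LINT x|lborel. p x * ((d - snd x) ^ j / fact j) * peano_kernel M s (fst x))) = (\<lambda>s. 0)"
        using p_d[OF _ j] by (auto simp: indicator_def)
      finally have "(LINT x|lborel. p x * ((d - snd x) ^ j / fact j) * ?D 0 j (fst x) d) = 0"
        by simp
      also have "(\<lambda>x. p x * ((d - snd x) ^ j / fact j) * ?D 0 j (fst x) d) =
          (\<lambda>x. p x * ?D 0 j (fst x) d * ((d - snd x) ^ j / fact j))"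
        by (simp only: mult.assoc mult.commute mult.left_commute)
      finally show "(- 1) ^ j * (LINT x|lborel. p x * ?D 0 j (fst x) d * ((d - snd x) ^ j / fact j)) = 0"
        by simp
    qed
    \<comment> \<open>The remainder in \<open>z\<close> is expanded in \<open>y\<close> for each
      fixed \<open>t\<close>. Here \<open>p_b\<close> removes the boundary terms, and the new
      remainder contains \<open>T\<close>; for \<open>t\<close> outside \<open>{c..d}\<close> both
      sides are 0.\<close>
    also have "(\<lambda>t. indicator {c..d} t *
        (LINT x|lborel. p x * ?D 0 (Suc N) (fst x) t * peano_kernel N t (snd x))) =
        (\<lambda>t. (- 1) ^ Suc M * (LINT s|lborel. T (s, t) * ?D (Suc M) (Suc N) s t))"
    proof
      fix t
      show "indicator {c..d} t * (LINT x|lborel. p x * ?D 0 (Suc N) (fst x) t * peano_kernel N t (snd x)) =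
        (- 1) ^ Suc M * (LINT s|lborel. T (s, t) * ?D (Suc M) (Suc N) s t)"
      proof (cases "t \<in> {c..d}")
        case True
        \<comment> \<open>For \<open>N = 0\<close> the kernel may jump at \<open>t\<close>, so
          integrability comes from its bound rather than from continuity.\<close>
        have "integrable lborel (\<lambda>x. p x * peano_kernel N t (snd x))"
        proof (rule Bochner_Integration.integrable_bound)
          show "integrable lborel (\<lambda>x. (d - c) ^ N * p x)"
            using p by simp
          show "AE x in lborel. norm (p x * peano_kernel N t (snd x)) \<le> norm ((d - c) ^ N * p x)"
          proof (intro AE_I2)
            fix x
            show "norm (p x * peano_kernel N t (snd x)) \<le> norm ((d - c) ^ N * p x)"
            proof (cases "x \<in> ?B")
              case x: True
              have "\<bar>peano_kernel N t (snd x)\<bar> \<le> (d - c) ^ N"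
                using x True by (intro peano_kernel_bounds) auto
              then show ?thesis
                using cd by (simp add: abs_mult mult.commute mult_left_mono)
            qed (simp add: p0)
          qed
        qed measurable
        then have "(LINT x|lborel. p x * peano_kernel N t (snd x) * ?D 0 (Suc N) (fst x) t) =
          (- 1) ^ Suc M * (LINT s|lborel. indicator {a..b} s * ?D (Suc M) (Suc N) s t *
            (LINT x|lborel. p x * peano_kernel N t (snd x) * peano_kernel M s (fst x)))"
          by (rule integral_partial_deriv_fst[OF _ _ f ab]) (use True p0 p_b in auto)
        also have "(\<lambda>x. p x * peano_kernel N t (snd x) * ?D 0 (Suc N) (fst x) t) =
            (\<lambda>x. p x * ?D 0 (Suc N) (fst x) t * peano_kernel N t (snd x))"
          by (simp only: mult.assoc mult.commute mult.left_commute)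
        also have "(\<lambda>s. indicator {a..b} s * ?D (Suc M) (Suc N) s t *
            (LINT x|lborel. p x * peano_kernel N t (snd x) * peano_kernel M s (fst x))) =
            (\<lambda>s. T (s, t) * ?D (Suc M) (Suc N) s t)"
          using True by (auto simp: T_def indicator_def)
        finally show ?thesis
          using True by simp
      qed (simp add: T_def)
    qed
    also have "(LINT t|lborel. (- 1) ^ Suc M * (LINT s|lborel. T (s, t) * ?D (Suc M) (Suc N) s t)) =
        (- 1) ^ Suc M * (LINT t|lborel. LINT s|lborel. T (s, t) * ?D (Suc M) (Suc N) s t)"
      by (simp only: integral_mult_right_zero)
    \<comment> \<open>Fubini's theorem with the second coordinate outermost, since \<open>s\<close>
      is the inner variable.\<close>
    also have "(LINT t|lborel. LINT s|lborel. T (s, t) * ?D (Suc M) (Suc N) s t) =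
        (LINT x|lborel. T x * ?D (Suc M) (Suc N) (fst x) (snd x))"
    proof -
      have "continuous_on ?B (\<lambda>x. ?D (Suc M) (Suc N) (fst x) (snd x))"
        by (rule continuous_on_partial_deriv[OF f]) (auto intro!: continuous_intros)
      then have "integrable lborel (\<lambda>x. T x * ?D (Suc M) (Suc N) (fst x) (snd x))"
        by (intro integrable_mult_continuous_on_compact[OF T T0 Bc]) auto
      then have "integrable (lborel \<Otimes>\<^sub>M lborel) (\<lambda>(s, t). T (s, t) * ?D (Suc M) (Suc N) s t)"
        by (simp add: lborel_prod case_prod_unfold)
      then show ?thesis
        by (subst lborel_pair.integral_snd) (simp_all add: lborel_prod case_prod_unfold)
    qed
    \<comment> \<open>The remainder signs have exponents \<open>Suc N\<close> and
      \<open>Suc M\<close>; the two additional factors -1 cancel.\<close>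
    finally show ?thesis
      by (simp add: power_add)
  qed
  then show thesis
    using T T_nonneg T0 that by blast
qed

section \<open>Mean value theorem for the quotient of the functionals\<close>

theorem theorem5p2:
  fixes a b c d :: real
    and M N :: nat
    and P f g :: "real \<Rightarrow> real \<Rightarrow> real"
  assumes "a < b" and "c < d"
    and "set_integrable lebesgue ({a..b} \<times> {c..d}) (\<lambda>(y, z). P y z)"
    and "C_on (M + 1) (N + 1) {a..b} {c..d} f"
    and "C_on (M + 1) (N + 1) {a..b} {c..d} g"
    and "nabla_convex_on (M + 1) (N + 1) {a..b} {c..d} f"
    and "nabla_convex_on (M + 1) (N + 1) {a..b} {c..d} g"
    and "\<forall>i\<in>{0..M}. \<forall>j\<in>{0..N}.
           iterated_integral a b c d
             (\<lambda>y z. P y z * ((b - y) ^ i / fact i) * ((d - z) ^ j / fact j)) = 0"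
    and "\<forall>j\<in>{0..N}. \<forall>s\<in>{a..b}.
           iterated_integral a s c d
             (\<lambda>y z. P y z * ((s - y) ^ M / fact M) * ((d - z) ^ j / fact j)) = 0"
    and "\<forall>i\<in>{0..M}. \<forall>t\<in>{c..d}.
           iterated_integral a b c t
             (\<lambda>y z. P y z * ((b - y) ^ i / fact i) * ((t - z) ^ N / fact N)) = 0"
    and "\<forall>s\<in>{a..b}. \<forall>t\<in>{c..d}.
           iterated_integral a s c t
             (\<lambda>y z. P y z * ((s - y) ^ M / fact M) * ((t - z) ^ N / fact N)) \<ge> 0"
    and "Lambda a b c d P g \<noteq> 0"
    and "\<forall>y\<in>{a..b}. \<forall>z\<in>{c..d}. partial_deriv {a..b} {c..d} (M + 1) (N + 1) g y z \<noteq> 0"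
  shows "\<exists>\<eta>\<in>{a..b}. \<exists>\<zeta>\<in>{c..d}.
           Lambda a b c d P f / Lambda a b c d P g =
           partial_deriv {a..b} {c..d} (M + 1) (N + 1) f \<eta> \<zeta> /
           partial_deriv {a..b} {c..d} (M + 1) (N + 1) g \<eta> \<zeta>"
proof -
  let ?D = "partial_deriv {a..b} {c..d} (M + 1) (N + 1)"
  let ?B = "{a..b} \<times> {c..d}"
  obtain T :: "real \<times> real \<Rightarrow> real" where T: "integrable lborel T" "\<And>x. 0 \<le> T x" "\<And>x. x \<notin> ?B \<Longrightarrow> T x = 0"
    and Lambda: "\<And>f. C_on (M + 1) (N + 1) {a..b} {c..d} f \<Longrightarrow>
      Lambda a b c d P f = (- 1) ^ (M + N) * (LINT x|lborel. T x * ?D f (fst x) (snd x))"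
    using Lambda_eq_integral_partial_deriv[OF less_imp_le[OF assms(1)] less_imp_le[OF assms(2)]
        assms(3,8,9,10,11)] by blast
  have cont: "continuous_on ?B (\<lambda>x. ?D h (fst x) (snd x))" if "C_on (M + 1) (N + 1) {a..b} {c..d} h" for h
    by (rule continuous_on_partial_deriv[OF that]) (auto intro!: continuous_intros)
  have "\<exists>x\<in>?B. (LINT x|lborel. T x * ?D f (fst x) (snd x)) / (LINT x|lborel. T x * ?D g (fst x) (snd x)) =
      ?D f (fst x) (snd x) / ?D g (fst x) (snd x)"
  proof (rule integral_ratio_eq_ratio[OF T _ _ _ cont[OF assms(4)] cont[OF assms(5)]])
    show "compact ?B" "connected ?B" "?B \<noteq> {}"
      using assms(1,2) by (auto intro: compact_Times connected_Times)
    show "(LINT x|lborel. T x * ?D g (fst x) (snd x)) \<noteq> 0"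
      using assms(12) Lambda[OF assms(5)] by auto
  qed (use assms(13) in auto)
  \<comment> \<open>The common factor \<open>(- 1) ^ (M + N)\<close> cancels in the
    quotient.\<close>
  then show ?thesis
    unfolding Lambda[OF assms(4)] Lambda[OF assms(5)] by auto
qed

end
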